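(* Let $k\ge2$ and let $R_1,\dots,R_k$ be commutative rings with identity. Then $\Gamma(R_1\times\cdots\times R_k)$ has a simplicial vertex if and only if some $\Gamma(R_i)$ has a simplicial vertex or $|R_i|=2$ for some $i$.
   Context: For a commutative ring $R$ with identity, the zero-divisor graph $\Gamma(R)$ is the simple undirected graph whose vertices are the nonzero zero-divisors of $R$, two distinct vertices $u,v$ being adjacent iff $uv=0$. A vertex is simplicial if its neighbors are pairwise adjacent. *)

theory Defs
  imports "HOL-Algebra.Chinese_Remainder" "Graph_Theory.Pair_Digraph"
begin

definition zero_divisor :: "('a, 'm) ring_scheme \<Rightarrow> 'a \<Rightarrow> bool" where
  "zero_divisor R x \<longleftrightarrow>
     x \<in> carrier R \<and> (\<exists>y \<in> carrier R. y \<noteq> \<zero>\<^bsub>R\<^esub> \<and> x \<otimes>\<^bsub>R\<^esub> y = \<zero>\<^bsub>R\<^esub>)"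

text \<open>
  An undirected graph is represented as a symmetric digraph without parallel arcs:
  the edge between \<open>u\<close> and \<open>v\<close> is the pair of arcs \<open>(u, v)\<close>, \<open>(v, u)\<close>.
\<close>

definition zero_divisor_graph :: "('a, 'm) ring_scheme \<Rightarrow> 'a pair_pre_digraph" where
  "zero_divisor_graph R =
    (let V = {x. zero_divisor R x \<and> x \<noteq> \<zero>\<^bsub>R\<^esub>}
     in \<lparr>pverts = V,
         parcs = {(u, v). u \<in> V \<and> v \<in> V \<and> u \<noteq> v \<and> u \<otimes>\<^bsub>R\<^esub> v = \<zero>\<^bsub>R\<^esub>}\<rparr>)"

text \<open>
  The locale \<^locale>\<open>pair_bidirected_digraph\<close> says that the graph is symmetric and loop-free;
  unlike \<^locale>\<open>pair_graph\<close> it does not require finiteness, which fails for infinite rings.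
\<close>

lemma pair_bidirected_digraph_zero_divisor_graph:
  assumes "cring R"
  shows "pair_bidirected_digraph (zero_divisor_graph R)"
proof -
  interpret cring R by fact
  have comm: "v \<otimes>\<^bsub>R\<^esub> u = \<zero>\<^bsub>R\<^esub>"
    if "zero_divisor R u" "zero_divisor R v" "u \<otimes>\<^bsub>R\<^esub> v = \<zero>\<^bsub>R\<^esub>" for u v
    using that m_comm[of u v] unfolding zero_divisor_def by metis
  show ?thesis
  proof
    show "symmetric (zero_divisor_graph R)"
      unfolding symmetric_def with_proj_simps
    proof (rule symI)
      fix u v
      assume "(u, v) \<in> parcs (zero_divisor_graph R)"
      then show "(v, u) \<in> parcs (zero_divisor_graph R)"
        using comm[of u v] unfolding zero_divisor_graph_def Let_def by auto
    qed
  qed (auto simp: zero_divisor_graph_def Let_def)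
qed

definition simplicial_vertex :: "'a pair_pre_digraph \<Rightarrow> 'a \<Rightarrow> bool" where
  "simplicial_vertex G v \<longleftrightarrow>
     v \<in> pverts G \<and> pairwise (\<lambda>a b. (a, b) \<in> parcs G) {a. (v, a) \<in> parcs G}"

end

theory Submission
  imports Defs
begin

text \<open>
  Let \<open>e\<^sub>i\<close> be the standard idempotents of the product. If \<open>u\<close> is simplicial and \<open>u\<^sub>i = 0\<close>, then every
  nonzero \<open>a e\<^sub>i\<close> is a neighbour of \<open>u\<close>; as \<open>a e\<^sub>i \<cdot> e\<^sub>i \<noteq> 0\<close>, there is no \<open>a\<close> other than \<open>0\<close> and \<open>1\<close>. If no
  \<open>u\<^sub>i\<close> vanishes, some \<open>u\<^sub>j\<close> is a nonzero zero-divisor, and \<open>a \<mapsto> a e\<^sub>j\<close> embeds its neighbours into those of \<open>u\<close>.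
  Conversely, take \<open>u\<close> to be \<open>1\<close> outside \<open>i\<close>, and at \<open>i\<close> either the given simplicial vertex or \<open>0\<close>
  when \<open>R\<^sub>i\<close> has two elements; all neighbours of \<open>u\<close> are then supported at \<open>i\<close>.
\<close>

section \<open>Simplicial vertices in terms of ring equations\<close>

text \<open>Any element annihilated by the nonzero \<open>u\<close> is automatically a zero-divisor,
  with \<open>u\<close> as witness. Hence the neighbourhood of \<open>u\<close> is cut out by
  equations and inequations in the ring alone.\<close>

lemma (in cring) simplicial_vertex_zero_divisor_graph_iff:
  "simplicial_vertex (zero_divisor_graph R) u \<longleftrightarrow>
     zero_divisor R u \<and> u \<noteq> \<zero> \<and>
     (\<forall>a\<in>carrier R. \<forall>b\<in>carrier R. a \<noteq> \<zero> \<longrightarrow> b \<noteq> \<zero> \<longrightarrow> a \<noteq> u \<longrightarrow> b \<noteq> u \<longrightarrow> a \<noteq> b \<longrightarrow>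
        u \<otimes> a = \<zero> \<longrightarrow> u \<otimes> b = \<zero> \<longrightarrow> a \<otimes> b = \<zero>)" (is "_ \<longleftrightarrow> ?zd \<and> ?nz \<and> _")
proof (cases "?zd \<and> ?nz")
  case False
  then show ?thesis
    by (auto simp: simplicial_vertex_def zero_divisor_graph_def Let_def)
next
  case True
  then have u: "u \<in> carrier R" and nz: ?nz
    by (simp_all add: zero_divisor_def)
  have zd: "zero_divisor R a" if "a \<in> carrier R" "u \<otimes> a = \<zero>" for a
    using that u nz m_comm[OF u] unfolding zero_divisor_def by auto
  have "(u, a) \<in> parcs (zero_divisor_graph R) \<longleftrightarrow>
      a \<in> carrier R \<and> a \<noteq> \<zero> \<and> a \<noteq> u \<and> u \<otimes> a = \<zero>" for a
    using True zd by (auto simp: zero_divisor_graph_def Let_def zero_divisor_def)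
  then have N: "{a. (u, a) \<in> parcs (zero_divisor_graph R)} =
      {a \<in> carrier R. a \<noteq> \<zero> \<and> a \<noteq> u \<and> u \<otimes> a = \<zero>}"
    by blast
  show ?thesis
    unfolding simplicial_vertex_def N pairwise_def
    using True zd by (auto simp: zero_divisor_graph_def Let_def)
qed

section \<open>Coordinatewise arithmetic in finite products\<close>

lemma RDirProd_list_carrier_iff:
  "xs \<in> carrier (RDirProd_list Rs) \<longleftrightarrow>
     length xs = length Rs \<and> (\<forall>i<length Rs. xs ! i \<in> carrier (Rs ! i))"
  using RDirProd_list_carrier_mem[of xs Rs] RDirProd_list_carrier_memI[of xs Rs] by auto

lemma RDirProd_list_zero_eq: "\<zero>\<^bsub>RDirProd_list Rs\<^esub> = map zero Rs"
  unfolding RDirProd_list_zero by (induction Rs) auto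

text \<open>Prepending a coordinate is a ring homomorphism from the binary product of
  \<open>R\<close> and \<open>RDirProd_list Rs\<close>, where multiplication is componentwise by
  definition.\<close>

lemma RDirProd_list_mult_Cons:
  assumes "x \<in> carrier R" "xs \<in> carrier (RDirProd_list Rs)"
    and "y \<in> carrier R" "ys \<in> carrier (RDirProd_list Rs)"
  shows "(x # xs) \<otimes>\<^bsub>RDirProd_list (R # Rs)\<^esub> (y # ys) = (x \<otimes>\<^bsub>R\<^esub> y) # (xs \<otimes>\<^bsub>RDirProd_list Rs\<^esub> ys)"
  using ring_hom_memE(2)[OF RDirProd_list_hom1, of "(x, xs)" R Rs "(y, ys)"] assms
  by (simp add: RDirProd_carrier) (simp add: RDirProd_def DirProd_def monoid.defs)

lemma RDirProd_list_mult_eq: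
  assumes "xs \<in> carrier (RDirProd_list Rs)" "ys \<in> carrier (RDirProd_list Rs)"
  shows "xs \<otimes>\<^bsub>RDirProd_list Rs\<^esub> ys = map (\<lambda>i. xs ! i \<otimes>\<^bsub>Rs ! i\<^esub> ys ! i) [0..<length Rs]"
  using assms
proof (induction Rs arbitrary: xs ys)
  case Nil
  then show ?case
    by (simp add: monoid.defs)
next
  case (Cons R Rs)
  from Cons.prems obtain x xs' y ys' where xs: "xs = x # xs'" "x \<in> carrier R" "xs' \<in> carrier (RDirProd_list Rs)"
    and ys: "ys = y # ys'" "y \<in> carrier R" "ys' \<in> carrier (RDirProd_list Rs)"
    unfolding RDirProd_list_carrier by auto
  \<comment> \<open>Index 0 is split off the range and the other indices are written as successors,
    to match the indexing of the tail in \<open>Cons.IH\<close>; \<open>upt_Suc\<close> would split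
    off the last index instead.\<close>
  show ?case
    unfolding xs(1) ys(1) RDirProd_list_mult_Cons[OF xs(2,3) ys(2,3)] Cons.IH[OF xs(3) ys(3)]
    by (simp add: upt_conv_Cons comp_def flip: map_Suc_upt del: upt_Suc)
qed

lemma RDirProd_list_mult_eq_zero_iff:
  assumes "xs \<in> carrier (RDirProd_list Rs)" "ys \<in> carrier (RDirProd_list Rs)"
  shows "xs \<otimes>\<^bsub>RDirProd_list Rs\<^esub> ys = \<zero>\<^bsub>RDirProd_list Rs\<^esub> \<longleftrightarrow>
    (\<forall>i<length Rs. xs ! i \<otimes>\<^bsub>Rs ! i\<^esub> ys ! i = \<zero>\<^bsub>Rs ! i\<^esub>)"
proof -
  \<comment> \<open>With both sides mapped over the same index range, equality of lists becomes
    equality at each index.\<close>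
  have "map zero Rs = map (\<lambda>i. \<zero>\<^bsub>Rs ! i\<^esub>) [0..<length Rs]"
    by (intro nth_equalityI) simp_all
  then show ?thesis
    unfolding RDirProd_list_mult_eq[OF assms] RDirProd_list_zero_eq by (simp add: Ball_def)
qed

lemma RDirProd_list_cring:
  assumes "\<And>i. i < length Rs \<Longrightarrow> cring (Rs ! i)"
  shows "cring (RDirProd_list Rs)"
proof -
  interpret ring "RDirProd_list Rs"
    using assms by (intro RDirProd_list_is_ring) (auto simp: cring_def)
  show ?thesis
  proof
    fix xs ys assume "xs \<in> carrier (RDirProd_list Rs)" "ys \<in> carrier (RDirProd_list Rs)"
    then show "xs \<otimes>\<^bsub>RDirProd_list Rs\<^esub> ys = ys \<otimes>\<^bsub>RDirProd_list Rs\<^esub> xs"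
      using assms
      by (auto simp: RDirProd_list_mult_eq RDirProd_list_carrier_iff intro!: cring.cring_simprules(14))
  qed
qed

text \<open>The distinct elements 0 and 1 already exhaust a two-element carrier. This lets the
  cardinality condition be proved and used through explicit elements.\<close>

lemma card_two_iff_carrier:
  assumes "ring R" "\<one>\<^bsub>R\<^esub> \<noteq> \<zero>\<^bsub>R\<^esub>"
  shows "card (carrier R) = 2 \<longleftrightarrow> carrier R = {\<zero>\<^bsub>R\<^esub>, \<one>\<^bsub>R\<^esub>}"
proof -
  interpret ring R by fact
  show ?thesis
  proof
    assume "card (carrier R) = 2"
    then obtain x y where xy: "carrier R = {x, y}"
      by (auto simp: card_2_iff)
    moreover have "\<zero>\<^bsub>R\<^esub> \<in> {x, y}" "\<one>\<^bsub>R\<^esub> \<in> {x, y}"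
      using zero_closed one_closed unfolding xy .
    ultimately show "carrier R = {\<zero>\<^bsub>R\<^esub>, \<one>\<^bsub>R\<^esub>}"
      using assms(2) by (elim insertE) auto
  qed (use assms(2) in simp)
qed

section \<open>Product elements concentrated at one coordinate\<close>

locale nonzero_crings =
  fixes Rs :: "('a, 'm) ring_scheme list"
  assumes crings: "i < length Rs \<Longrightarrow> cring (Rs ! i)"
    and one_neq_zero: "i < length Rs \<Longrightarrow> \<one>\<^bsub>Rs ! i\<^esub> \<noteq> \<zero>\<^bsub>Rs ! i\<^esub>"
begin

abbreviation "P \<equiv> RDirProd_list Rs"

sublocale P: cring P
  using crings by (rule RDirProd_list_cring)

text \<open>The multiple \<open>a e\<^sub>i\<close> of a standard idempotent.\<close>

definition supp_at :: "nat \<Rightarrow> 'a \<Rightarrow> 'a list" where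
  "supp_at i a = (map zero Rs)[i := a]"

text \<open>The candidate vertex for the converse: its coordinates outside \<open>i\<close> are
  units, which confines its annihilator to coordinate \<open>i\<close>.\<close>

definition one_off :: "nat \<Rightarrow> 'a \<Rightarrow> 'a list" where
  "one_off i a = (map one Rs)[i := a]"

lemma supp_at_nth: "j < length Rs \<Longrightarrow> supp_at i a ! j = (if j = i then a else \<zero>\<^bsub>Rs ! j\<^esub>)"
  by (auto simp: supp_at_def nth_list_update)

lemma one_off_nth: "j < length Rs \<Longrightarrow> one_off i a ! j = (if j = i then a else \<one>\<^bsub>Rs ! j\<^esub>)"
  by (auto simp: one_off_def nth_list_update)

lemma nth_closed: "xs \<in> carrier P \<Longrightarrow> i < length Rs \<Longrightarrow> xs ! i \<in> carrier (Rs ! i)"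
  by (simp add: RDirProd_list_carrier_iff)

lemma zero_one_closed:
  assumes "i < length Rs"
  shows "\<zero>\<^bsub>Rs ! i\<^esub> \<in> carrier (Rs ! i)" "\<one>\<^bsub>Rs ! i\<^esub> \<in> carrier (Rs ! i)"
  using cring.cring_simprules(2,6)[OF crings[OF assms]] by auto

lemma mult_zero:
  assumes "i < length Rs" "a \<in> carrier (Rs ! i)"
  shows "\<zero>\<^bsub>Rs ! i\<^esub> \<otimes>\<^bsub>Rs ! i\<^esub> a = \<zero>\<^bsub>Rs ! i\<^esub>" "a \<otimes>\<^bsub>Rs ! i\<^esub> \<zero>\<^bsub>Rs ! i\<^esub> = \<zero>\<^bsub>Rs ! i\<^esub>"
  using cring.cring_simprules(26,27)[OF crings[OF assms(1)] assms(2)] by auto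

lemma supp_at_closed: "i < length Rs \<Longrightarrow> a \<in> carrier (Rs ! i) \<Longrightarrow> supp_at i a \<in> carrier P"
  using zero_one_closed by (auto simp: RDirProd_list_carrier_iff supp_at_nth) (simp add: supp_at_def)

lemma one_off_closed: "i < length Rs \<Longrightarrow> a \<in> carrier (Rs ! i) \<Longrightarrow> one_off i a \<in> carrier P"
  using zero_one_closed by (auto simp: RDirProd_list_carrier_iff one_off_nth) (simp add: one_off_def)

lemma eq_iff:
  assumes "xs \<in> carrier P" "ys \<in> carrier P"
  shows "xs = ys \<longleftrightarrow> (\<forall>i<length Rs. xs ! i = ys ! i)"
  using assms by (auto simp: RDirProd_list_carrier_iff intro: nth_equalityI)

lemma eq_zero_iff:
  assumes "xs \<in> carrier P"
  shows "xs = \<zero>\<^bsub>P\<^esub> \<longleftrightarrow> (\<forall>i<length Rs. xs ! i = \<zero>\<^bsub>Rs ! i\<^esub>)"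
  using eq_iff[OF assms P.zero_closed] by (simp add: RDirProd_list_zero_eq)

lemma supp_at_eq_zero_iff:
  assumes "i < length Rs" "a \<in> carrier (Rs ! i)"
  shows "supp_at i a = \<zero>\<^bsub>P\<^esub> \<longleftrightarrow> a = \<zero>\<^bsub>Rs ! i\<^esub>"
  using assms by (auto simp: eq_zero_iff supp_at_closed supp_at_nth)

lemma supp_at_inject:
  assumes "i < length Rs" "supp_at i a = supp_at i b"
  shows "a = b"
  using supp_at_nth[OF assms(1), of i] assms(2) by metis

text \<open>Outside \<open>i\<close> every coordinate of the product has a factor 0, so only
  coordinate \<open>i\<close> imposes a condition.\<close>

lemma mult_supp_at_eq_zero_iff:
  assumes "i < length Rs" "a \<in> carrier (Rs ! i)" "xs \<in> carrier P"
  shows "xs \<otimes>\<^bsub>P\<^esub> supp_at i a = \<zero>\<^bsub>P\<^esub> \<longleftrightarrow> xs ! i \<otimes>\<^bsub>Rs ! i\<^esub> a = \<zero>\<^bsub>Rs ! i\<^esub>"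
  using assms by (auto simp: RDirProd_list_mult_eq_zero_iff supp_at_closed supp_at_nth mult_zero nth_closed)

lemma supp_at_mult_supp_at_eq_zero_iff:
  assumes "i < length Rs" "a \<in> carrier (Rs ! i)" "b \<in> carrier (Rs ! i)"
  shows "supp_at i a \<otimes>\<^bsub>P\<^esub> supp_at i b = \<zero>\<^bsub>P\<^esub> \<longleftrightarrow> a \<otimes>\<^bsub>Rs ! i\<^esub> b = \<zero>\<^bsub>Rs ! i\<^esub>"
  using assms by (simp add: mult_supp_at_eq_zero_iff supp_at_closed supp_at_nth)

text \<open>At \<open>j \<noteq> i\<close> the equation reads \<open>1 * xs ! j = 0\<close> and
  kills that coordinate of \<open>xs\<close>; what remains is the equation at
  \<open>i\<close>.\<close>

lemma one_off_annihilator: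
  assumes i: "i < length Rs" and a: "a \<in> carrier (Rs ! i)"
    and xs: "xs \<in> carrier P" and ann: "one_off i a \<otimes>\<^bsub>P\<^esub> xs = \<zero>\<^bsub>P\<^esub>"
  shows "xs = supp_at i (xs ! i)" "a \<otimes>\<^bsub>Rs ! i\<^esub> xs ! i = \<zero>\<^bsub>Rs ! i\<^esub>"
proof -
  have *: "one_off i a ! j \<otimes>\<^bsub>Rs ! j\<^esub> xs ! j = \<zero>\<^bsub>Rs ! j\<^esub>" if "j < length Rs" for j
    using ann that by (simp add: RDirProd_list_mult_eq_zero_iff one_off_closed i a xs)
  show "a \<otimes>\<^bsub>Rs ! i\<^esub> xs ! i = \<zero>\<^bsub>Rs ! i\<^esub>"
    using *[OF i] by (simp add: one_off_nth i)
  have "xs ! j = \<zero>\<^bsub>Rs ! j\<^esub>" if "j < length Rs" "j \<noteq> i" for j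
    using *[OF that(1)] that cring.cring_simprules(12)[OF crings[OF that(1)] nth_closed[OF xs that(1)]]
    by (simp add: one_off_nth)
  then show "xs = supp_at i (xs ! i)"
    by (subst eq_iff) (auto simp: supp_at_nth supp_at_closed nth_closed xs i)
qed

section \<open>From a factor to the product\<close>

text \<open>All neighbours of \<open>one_off i u\<close> have the form \<open>supp_at i a\<close>
  with \<open>u * a = 0\<close>, so adjacency among them is decided in \<open>Rs ! i\<close>. Asking
  for a zero-divisor rather than a vertex admits \<open>u = 0\<close>, the choice for a two-element
  factor. The clique condition includes \<open>a = u\<close> and \<open>b = u\<close>, because
  \<open>supp_at i u\<close> differs from \<open>one_off i u\<close>.\<close>

lemma one_off_simplicial:
  assumes len: "length Rs \<ge> 2" and i: "i < length Rs" and u: "zero_divisor (Rs ! i) u"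
    and clique: "\<And>a b. a \<in> carrier (Rs ! i) \<Longrightarrow> b \<in> carrier (Rs ! i) \<Longrightarrow> a \<noteq> \<zero>\<^bsub>Rs ! i\<^esub> \<Longrightarrow> b \<noteq> \<zero>\<^bsub>Rs ! i\<^esub> \<Longrightarrow>
      a \<noteq> b \<Longrightarrow> u \<otimes>\<^bsub>Rs ! i\<^esub> a = \<zero>\<^bsub>Rs ! i\<^esub> \<Longrightarrow> u \<otimes>\<^bsub>Rs ! i\<^esub> b = \<zero>\<^bsub>Rs ! i\<^esub> \<Longrightarrow> a \<otimes>\<^bsub>Rs ! i\<^esub> b = \<zero>\<^bsub>Rs ! i\<^esub>"
  shows "simplicial_vertex (zero_divisor_graph P) (one_off i u)"
proof -
  obtain y where y: "y \<in> carrier (Rs ! i)" "y \<noteq> \<zero>\<^bsub>Rs ! i\<^esub>" "u \<otimes>\<^bsub>Rs ! i\<^esub> y = \<zero>\<^bsub>Rs ! i\<^esub>"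
    and uc: "u \<in> carrier (Rs ! i)"
    using u by (auto simp: zero_divisor_def)
  have closed: "one_off i u \<in> carrier P"
    using i uc by (rule one_off_closed)
  have "one_off i u \<otimes>\<^bsub>P\<^esub> supp_at i y = \<zero>\<^bsub>P\<^esub>"
    using i y closed by (simp add: mult_supp_at_eq_zero_iff one_off_nth)
  then have zd: "zero_divisor P (one_off i u)"
    using closed supp_at_closed[OF i y(1)] supp_at_eq_zero_iff[OF i y(1)] y(2)
    unfolding zero_divisor_def by blast
  \<comment> \<open>A second coordinate carries a 1, which keeps the vertex nonzero even if
    \<open>u = 0\<close>.\<close>
  obtain j where "j < length Rs" "j \<noteq> i"
    using len by (intro that[of "if i = 0 then 1 else 0"]) auto
  then have nz: "one_off i u \<noteq> \<zero>\<^bsub>P\<^esub>"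
    using one_neq_zero[of j] by (auto simp: eq_zero_iff closed one_off_nth)
  have "a \<otimes>\<^bsub>P\<^esub> b = \<zero>\<^bsub>P\<^esub>"
    if ab: "a \<in> carrier P" "b \<in> carrier P" "a \<noteq> \<zero>\<^bsub>P\<^esub>" "b \<noteq> \<zero>\<^bsub>P\<^esub>" "a \<noteq> b"
      and ann: "one_off i u \<otimes>\<^bsub>P\<^esub> a = \<zero>\<^bsub>P\<^esub>" "one_off i u \<otimes>\<^bsub>P\<^esub> b = \<zero>\<^bsub>P\<^esub>" for a b
  proof -
    note A = one_off_annihilator[OF i uc ab(1) ann(1)]
    note B = one_off_annihilator[OF i uc ab(2) ann(2)]
    have c: "a ! i \<in> carrier (Rs ! i)" "b ! i \<in> carrier (Rs ! i)"
      using ab i by (auto intro: nth_closed)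
    have "a ! i \<otimes>\<^bsub>Rs ! i\<^esub> b ! i = \<zero>\<^bsub>Rs ! i\<^esub>"
    proof (rule clique)
      show "a ! i \<noteq> \<zero>\<^bsub>Rs ! i\<^esub>" "b ! i \<noteq> \<zero>\<^bsub>Rs ! i\<^esub>"
        using ab(3,4) A(1) B(1) supp_at_eq_zero_iff[OF i] c by metis+
      show "a ! i \<noteq> b ! i"
        using ab(5) A(1) B(1) by metis
    qed (use c A(2) B(2) in auto)
    then show ?thesis
      using supp_at_mult_supp_at_eq_zero_iff[OF i c] A(1) B(1) by metis
  qed
  then show ?thesis
    unfolding P.simplicial_vertex_zero_divisor_graph_iff using zd nz by blast
qed

section \<open>From the product to a factor\<close>

lemma simplicial_component_or_card_two:
  assumes len: "length Rs \<ge> 2" and simp: "simplicial_vertex (zero_divisor_graph P) u"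
  shows "(\<exists>i < length Rs. \<exists>v. simplicial_vertex (zero_divisor_graph (Rs ! i)) v) \<or>
    (\<exists>i < length Rs. card (carrier (Rs ! i)) = 2)"
proof -
  from simp have zd: "zero_divisor P u" and nz: "u \<noteq> \<zero>\<^bsub>P\<^esub>"
    and clique: "\<And>a b. a \<in> carrier P \<Longrightarrow> b \<in> carrier P \<Longrightarrow> a \<noteq> \<zero>\<^bsub>P\<^esub> \<Longrightarrow> b \<noteq> \<zero>\<^bsub>P\<^esub> \<Longrightarrow> a \<noteq> u \<Longrightarrow>
        b \<noteq> u \<Longrightarrow> a \<noteq> b \<Longrightarrow> u \<otimes>\<^bsub>P\<^esub> a = \<zero>\<^bsub>P\<^esub> \<Longrightarrow> u \<otimes>\<^bsub>P\<^esub> b = \<zero>\<^bsub>P\<^esub> \<Longrightarrow> a \<otimes>\<^bsub>P\<^esub> b = \<zero>\<^bsub>P\<^esub>"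
    unfolding P.simplicial_vertex_zero_divisor_graph_iff by blast+
  then obtain y where u: "u \<in> carrier P" and y: "y \<in> carrier P" "y \<noteq> \<zero>\<^bsub>P\<^esub>" "u \<otimes>\<^bsub>P\<^esub> y = \<zero>\<^bsub>P\<^esub>"
    by (auto simp: zero_divisor_def)
  \<comment> \<open>The clique property of \<open>u\<close> is tested on elements supported at
    \<open>i\<close>. A vertex is not its own neighbour, hence the assumption \<open>neq\<close>,
    which the two cases below discharge differently.\<close>
  have clique_at: "a \<otimes>\<^bsub>Rs ! i\<^esub> b = \<zero>\<^bsub>Rs ! i\<^esub>"
    if i: "i < length Rs" and ab: "a \<in> carrier (Rs ! i)" "b \<in> carrier (Rs ! i)"
      "a \<noteq> \<zero>\<^bsub>Rs ! i\<^esub>" "b \<noteq> \<zero>\<^bsub>Rs ! i\<^esub>" "a \<noteq> b"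
      and ann: "u ! i \<otimes>\<^bsub>Rs ! i\<^esub> a = \<zero>\<^bsub>Rs ! i\<^esub>" "u ! i \<otimes>\<^bsub>Rs ! i\<^esub> b = \<zero>\<^bsub>Rs ! i\<^esub>"
      and neq: "supp_at i a \<noteq> u" "supp_at i b \<noteq> u" for i a b
  proof -
    have "supp_at i a \<otimes>\<^bsub>P\<^esub> supp_at i b = \<zero>\<^bsub>P\<^esub>"
      by (rule clique)
        (use that u supp_at_inject[OF i, of a b] in
          \<open>auto simp: supp_at_closed supp_at_eq_zero_iff mult_supp_at_eq_zero_iff\<close>)
    then show ?thesis
      by (simp add: supp_at_mult_supp_at_eq_zero_iff i ab)
  qed
  show ?thesis
  proof (cases "\<exists>i<length Rs. u ! i = \<zero>\<^bsub>Rs ! i\<^esub>")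
    case True
    then obtain i where i: "i < length Rs" and ui: "u ! i = \<zero>\<^bsub>Rs ! i\<^esub>"
      by blast
    interpret Ri: cring "Rs ! i"
      using i by (rule crings)
    \<comment> \<open>The two sides differ at coordinate \<open>i\<close>, where \<open>u\<close> is
      0.\<close>
    have neq: "supp_at i a \<noteq> u" if "a \<noteq> \<zero>\<^bsub>Rs ! i\<^esub>" for a
      using that ui supp_at_nth[OF i, of i a] by auto
    have "a = \<one>\<^bsub>Rs ! i\<^esub>" if a: "a \<in> carrier (Rs ! i)" "a \<noteq> \<zero>\<^bsub>Rs ! i\<^esub>" for a
    proof (rule ccontr)
      assume "a \<noteq> \<one>\<^bsub>Rs ! i\<^esub>"
      have "a \<otimes>\<^bsub>Rs ! i\<^esub> \<one>\<^bsub>Rs ! i\<^esub> = \<zero>\<^bsub>Rs ! i\<^esub>"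
        by (rule clique_at) (use \<open>a \<noteq> \<one>\<^bsub>Rs ! i\<^esub>\<close> i a ui neq one_neq_zero[OF i] in auto)
      with a show False
        by simp
    qed
    then have "carrier (Rs ! i) = {\<zero>\<^bsub>Rs ! i\<^esub>, \<one>\<^bsub>Rs ! i\<^esub>}"
      by auto
    then show ?thesis
      using i one_neq_zero[OF i] by (auto simp: card_two_iff_carrier Ri.ring_axioms)
  next
    case False
    \<comment> \<open>A nonzero coordinate of the annihilator \<open>y\<close> locates the factor in
      which \<open>u ! j\<close> is a zero-divisor.\<close>
    obtain j where j: "j < length Rs" and yj: "y ! j \<noteq> \<zero>\<^bsub>Rs ! j\<^esub>"
      using y by (auto simp: eq_zero_iff)
    interpret Rj: cring "Rs ! j"
      using j by (rule crings)
    \<comment> \<open>At a second coordinate \<open>l\<close>, \<open>supp_at j a\<close> is 0 but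
      \<open>u\<close> is not, so the two never coincide.\<close>
    obtain l where l: "l < length Rs" "l \<noteq> j"
      using len by (intro that[of "if j = 0 then 1 else 0"]) auto
    have neq: "supp_at j a \<noteq> u" for a
      using False l supp_at_nth[OF l(1), of j a] by auto
    have "u ! j \<otimes>\<^bsub>Rs ! j\<^esub> y ! j = \<zero>\<^bsub>Rs ! j\<^esub>"
      using y u j by (simp add: RDirProd_list_mult_eq_zero_iff)
    then have "zero_divisor (Rs ! j) (u ! j)"
      using yj u y j unfolding zero_divisor_def by (blast intro: nth_closed)
    then have "simplicial_vertex (zero_divisor_graph (Rs ! j)) (u ! j)"
      unfolding Rj.simplicial_vertex_zero_divisor_graph_iff
      using False j neq clique_at[OF j] by blast
    then show ?thesis
      using j by blast
  qed
qed

end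

section \<open>The equivalence, with both sources of a simplicial vertex\<close>

theorem theorem3p11:
  fixes Rs :: "('a, 'm) ring_scheme list"
  assumes "length Rs \<ge> 2"
    and "\<And>i. i < length Rs \<Longrightarrow> cring (Rs ! i)"
    and "\<And>i. i < length Rs \<Longrightarrow> \<one>\<^bsub>Rs ! i\<^esub> \<noteq> \<zero>\<^bsub>Rs ! i\<^esub>"
  shows "(\<exists>u. simplicial_vertex (zero_divisor_graph (RDirProd_list Rs)) u) \<longleftrightarrow>
    (\<exists>i < length Rs. \<exists>u. simplicial_vertex (zero_divisor_graph (Rs ! i)) u) \<or>
    (\<exists>i < length Rs. card (carrier (Rs ! i)) = 2)"
proof -
  interpret nonzero_crings Rs
    by (rule nonzero_crings.intro) (fact assms)+
  have "\<exists>v. simplicial_vertex (zero_divisor_graph P) v"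
    if i: "i < length Rs" and u: "simplicial_vertex (zero_divisor_graph (Rs ! i)) u" for i u
  proof -
    interpret Ri: cring "Rs ! i"
      using i by (rule crings)
    have zd: "zero_divisor (Rs ! i) u"
      and clique: "\<And>a b. a \<in> carrier (Rs ! i) \<Longrightarrow> b \<in> carrier (Rs ! i) \<Longrightarrow> a \<noteq> \<zero>\<^bsub>Rs ! i\<^esub> \<Longrightarrow>
        b \<noteq> \<zero>\<^bsub>Rs ! i\<^esub> \<Longrightarrow> a \<noteq> u \<Longrightarrow> b \<noteq> u \<Longrightarrow> a \<noteq> b \<Longrightarrow> u \<otimes>\<^bsub>Rs ! i\<^esub> a = \<zero>\<^bsub>Rs ! i\<^esub> \<Longrightarrow>
        u \<otimes>\<^bsub>Rs ! i\<^esub> b = \<zero>\<^bsub>Rs ! i\<^esub> \<Longrightarrow> a \<otimes>\<^bsub>Rs ! i\<^esub> b = \<zero>\<^bsub>Rs ! i\<^esub>"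
      using u unfolding Ri.simplicial_vertex_zero_divisor_graph_iff by blast+
    have "simplicial_vertex (zero_divisor_graph P) (one_off i u)"
    proof (rule one_off_simplicial[OF assms(1) i zd])
      fix a b
      assume ab: "a \<in> carrier (Rs ! i)" "b \<in> carrier (Rs ! i)" "a \<noteq> \<zero>\<^bsub>Rs ! i\<^esub>" "b \<noteq> \<zero>\<^bsub>Rs ! i\<^esub>" "a \<noteq> b"
        and ann: "u \<otimes>\<^bsub>Rs ! i\<^esub> a = \<zero>\<^bsub>Rs ! i\<^esub>" "u \<otimes>\<^bsub>Rs ! i\<^esub> b = \<zero>\<^bsub>Rs ! i\<^esub>"
      \<comment> \<open>If \<open>u\<^sup>2 = 0\<close>, then \<open>u\<close> itself, though not its own neighbour in the component, gives a
        neighbour of \<open>one_off i u\<close>.\<close>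
      consider "a = u" | "b = u" | "a \<noteq> u" "b \<noteq> u"
        by blast
      then show "a \<otimes>\<^bsub>Rs ! i\<^esub> b = \<zero>\<^bsub>Rs ! i\<^esub>"
      proof cases
        case 2
        then show ?thesis
          using ann(1) ab Ri.m_comm by metis
      qed (use ab ann clique in auto)
    qed
    then show ?thesis
      by blast
  qed
  moreover have "\<exists>v. simplicial_vertex (zero_divisor_graph P) v"
    if i: "i < length Rs" and card: "card (carrier (Rs ! i)) = 2" for i
  proof -
    interpret Ri: cring "Rs ! i"
      using i by (rule crings)
    have carr: "carrier (Rs ! i) = {\<zero>\<^bsub>Rs ! i\<^esub>, \<one>\<^bsub>Rs ! i\<^esub>}"
      using card one_neq_zero[OF i] by (simp add: card_two_iff_carrier Ri.ring_axioms)
    \<comment> \<open>Here 0 is a zero-divisor with witness 1, although it is not a vertex of the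
      graph of \<open>Rs ! i\<close>.\<close>
    have "zero_divisor (Rs ! i) \<zero>\<^bsub>Rs ! i\<^esub>"
      unfolding zero_divisor_def using one_neq_zero[OF i] Ri.one_closed by auto
    then have "simplicial_vertex (zero_divisor_graph P) (one_off i \<zero>\<^bsub>Rs ! i\<^esub>)"
      \<comment> \<open>The clique condition is vacuous: \<open>Rs ! i\<close> has only one nonzero
        element.\<close>
      by (rule one_off_simplicial[OF assms(1) i]) (use carr in auto)
    then show ?thesis
      by blast
  qed
  ultimately show ?thesis
    using simplicial_component_or_card_two[OF assms(1)] by blast
qed

end
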